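(* Let $\Omega$ be a domain in $\mathbb{C}^n$ and let $p\in\partial\Omega$ be both a $v$-point and a $w$-point. Then for any neighbourhood $U$ of $p$ we have $$\lim_{z,w\to p}\left(k_{\Omega\cap U}(z,w)-k_\Omega(z,w)\right)=0,$$ where the limit is taken over pairs $z,w$ of points lying in the same connected component of $\Omega\cap U$.
   Context: A domain is a non-empty connected open set; $\Delta\subset\mathbb{C}$ is the unit disc and $\mathcal{O}(\Delta,\Omega)$ is the set of holomorphic maps $\Delta\to\Omega$. The Lempert function of a domain $\Omega$ is $l_\Omega(z,w):=\tanh^{-1}\tilde l_\Omega(z,w)$, where $\tilde l_\Omega(z,w):=\inf\{|\alpha|:\alpha\in\Delta,\ \exists\varphi\in\mathcal{O}(\Delta,\Omega)\text{ with }\varphi(0)=z,\ \varphi(\alpha)=w\}$. The Kobayashi distance $k_\Omega$ is the largest pseudodistance on $\Omega$ not exceeding $l_\Omega$. If $\Omega\cap U$ is not connected and $z,w$ lie in the same connected component $D$ of $\Omega\cap U$, then $k_{\Omega\cap U}(z,w)$ means $k_D(z,w)$. The Gromov product is $(z|w)^\Omega_o=\frac12\left(k_\Omega(z,o)+k_\Omega(w,o)-k_\Omega(z,w)\right)$ for $z,w,o\in\Omega$. A point $p\in\partial\Omega$ is a $v$-point if $\Omega$ satisfies the weak Gromov property at $p$, i.e. $$\liminf_{z\to p,\ w\to q}\left(k_\Omega(z,w)-k_\Omega(z,o)\right)>-\infty\qquad\text{for all } o\in\Omega\text{ and all } q\in\partial\Omega,\ q\neq p$$ (here $z,w\in\Omega$).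 A point $p\in\partial\Omega$ is a $w$-point if for any neighbourhood $U$ of $p$ such that $\Omega\setminus U$ is non-empty, $$\lim_{z,w\to p}\Big(\inf_{o\in\Omega\setminus U}(z|w)^\Omega_o\Big)=\infty .$$ *)

theory Defs
  imports
    "HOL-Analysis.Analysis"
    "HOL-Complex_Analysis.Riemann_Mapping"
    "HOL-Library.Extended_Real"
    "HOL-Library.Liminf_Limsup"
begin

definition is_domain :: "(complex ^ 'n) set \<Rightarrow> bool" where
  "is_domain \<Omega> \<longleftrightarrow> \<Omega> \<noteq> {} \<and> open \<Omega> \<and> connected \<Omega>"

(* Holomorphic maps into complex n-space are the componentwise holomorphic ones. *)
definition holo_discs :: "(complex ^ 'n) set \<Rightarrow> (complex \<Rightarrow> complex ^ 'n) set" where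
  "holo_discs \<Omega> = {\<phi>. (\<forall>i. (\<lambda>\<zeta>. \<phi> \<zeta> $ i) holomorphic_on ball 0 1) \<and> \<phi> ` ball 0 1 \<subseteq> \<Omega>}"

(* The infimum is taken in the reals; on a domain the set is non-empty and bounded below
   (lemma lempert_set_nonempty below), so it is the true infimum and lies in [0,1). *)
definition lempert_tilde :: "(complex ^ 'n) set \<Rightarrow> complex ^ 'n \<Rightarrow> complex ^ 'n \<Rightarrow> real" where
  "lempert_tilde \<Omega> z w =
     Inf {cmod \<alpha> | \<alpha>. \<alpha> \<in> ball 0 1 \<and> (\<exists>\<phi>\<in>holo_discs \<Omega>. \<phi> 0 = z \<and> \<phi> \<alpha> = w)}"

definition lempert :: "(complex ^ 'n) set \<Rightarrow> complex ^ 'n \<Rightarrow> complex ^ 'n \<Rightarrow> real" where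
  "lempert \<Omega> z w = artanh (lempert_tilde \<Omega> z w)"

definition pseudodistance_on :: "'a set \<Rightarrow> ('a \<Rightarrow> 'a \<Rightarrow> real) \<Rightarrow> bool" where
  "pseudodistance_on S d \<longleftrightarrow>
     (\<forall>x\<in>S. \<forall>y\<in>S. 0 \<le> d x y) \<and>
     (\<forall>x\<in>S. d x x = 0) \<and>
     (\<forall>x\<in>S. \<forall>y\<in>S. d x y = d y x) \<and>
     (\<forall>x\<in>S. \<forall>y\<in>S. \<forall>z\<in>S. d x z \<le> d x y + d y z)"

(* The largest pseudodistance below the Lempert function is the pointwise supremum of all of them;
   lemmas pseudodistance_on_kobayashi, kobayashi_le_lempert and kobayashi_greatest below confirm
   that on a domain this supremum is indeed the greatest such pseudodistance. *)
definition kobayashi :: "(complex ^ 'n) set \<Rightarrow> complex ^ 'n \<Rightarrow> complex ^ 'n \<Rightarrow> real" where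
  "kobayashi \<Omega> z w =
     Sup {d z w | d. pseudodistance_on \<Omega> d \<and> (\<forall>x\<in>\<Omega>. \<forall>y\<in>\<Omega>. d x y \<le> lempert \<Omega> x y)}"

(* Kobayashi distance of a possibly disconnected open set D, meaningful for z and w in the same
   connected component of D: the distance of that component.  It agrees with kobayashi D if D is
   connected. *)
definition kobayashi_comp :: "(complex ^ 'n) set \<Rightarrow> complex ^ 'n \<Rightarrow> complex ^ 'n \<Rightarrow> real" where
  "kobayashi_comp D z w = kobayashi (connected_component_set D z) z w"

definition gromov_product ::
  "(complex ^ 'n) set \<Rightarrow> complex ^ 'n \<Rightarrow> complex ^ 'n \<Rightarrow> complex ^ 'n \<Rightarrow> real" where
  "gromov_product \<Omega> o' z w =
     (kobayashi \<Omega> z o' + kobayashi \<Omega> w o' - kobayashi \<Omega> z w) / 2"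

definition v_point :: "(complex ^ 'n) set \<Rightarrow> complex ^ 'n \<Rightarrow> bool" where
  "v_point \<Omega> p \<longleftrightarrow> p \<in> frontier \<Omega> \<and>
     (\<forall>o'\<in>\<Omega>. \<forall>q\<in>frontier \<Omega>. q \<noteq> p \<longrightarrow>
        Liminf (at (p, q) within \<Omega> \<times> \<Omega>)
          (\<lambda>(z, w). ereal (kobayashi \<Omega> z w - kobayashi \<Omega> z o')) > -\<infinity>)"

(* Restricting to open neighbourhoods loses nothing: the infimum is over a larger set for a smaller
   neighbourhood.  The real infimum is over a non-empty set and bounded below by 0, by the triangle
   inequality for the Kobayashi distance. *)
definition w_point :: "(complex ^ 'n) set \<Rightarrow> complex ^ 'n \<Rightarrow> bool" where
  "w_point \<Omega> p \<longleftrightarrow> p \<in> frontier \<Omega> \<and>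
     (\<forall>U. open U \<and> p \<in> U \<and> \<Omega> - U \<noteq> {} \<longrightarrow>
        filterlim (\<lambda>(z, w). INF o'\<in>\<Omega> - U. gromov_product \<Omega> o' z w)
          at_top (at (p, p) within \<Omega> \<times> \<Omega>))"

lemma lempert_set_nonempty:
  fixes \<Omega> :: "(complex ^ 'n) set"
  assumes "is_domain \<Omega>" "z \<in> \<Omega>" "w \<in> \<Omega>"
  shows "\<exists>\<alpha>\<in>ball 0 1. \<exists>\<phi>\<in>holo_discs \<Omega>. \<phi> 0 = z \<and> \<phi> \<alpha> = w"
proof -
  have op: "open \<Omega>" and co: "connected \<Omega>"
    using assms by (auto simp: is_domain_def)
  obtain g :: "real \<Rightarrow> complex ^ 'n" where g: "polynomial_function g"
    and gim: "path_image g \<subseteq> \<Omega>" and g0: "g 0 = z" and g1: "g 1 = w"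
    using connected_open_polynomial_connected[OF op co assms(2,3)]
    by (auto simp: pathstart_def pathfinish_def)
  have "\<exists>F. F holomorphic_on UNIV \<and> (\<forall>t::real. F (of_real t) = g t $ i)" for i
  proof -
    have *: "real_polynomial_function (\<lambda>t. g t \<bullet> axis i c)" for c
      using g bounded_linear_inner_left[of "axis i c"]
      unfolding polynomial_function_def o_def by blast
    obtain a m where a: "(\<lambda>t. g t \<bullet> axis i 1) = (\<lambda>x. \<Sum>j\<le>m. a j * x ^ j)"
      using * [of 1] real_polynomial_function_iff_sum by blast
    obtain b k where b: "(\<lambda>t. g t \<bullet> axis i \<i>) = (\<lambda>x. \<Sum>j\<le>k. b j * x ^ j)"
      using * [of \<i>] real_polynomial_function_iff_sum by blast
    define F where "F = (\<lambda>\<zeta>::complex. (\<Sum>j\<le>m. of_real (a j) * \<zeta> ^ j)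
                                      + \<i> * (\<Sum>j\<le>k. of_real (b j) * \<zeta> ^ j))"
    have "F holomorphic_on UNIV"
      unfolding F_def by (intro holomorphic_intros)
    moreover have "F (of_real t) = g t $ i" for t
    proof -
      have "Re (g t $ i) = (\<Sum>j\<le>m. a j * t ^ j)"
        using fun_cong[OF a, of t] by (simp add: inner_axis inner_complex_def)
      moreover have "Im (g t $ i) = (\<Sum>j\<le>k. b j * t ^ j)"
        using fun_cong[OF b, of t] by (simp add: inner_axis inner_complex_def)
      ultimately have "g t $ i = of_real (\<Sum>j\<le>m. a j * t ^ j) + \<i> * of_real (\<Sum>j\<le>k. b j * t ^ j)"
        by (simp add: complex_eq_iff)
      then show ?thesis by (simp add: F_def)
    qed
    ultimately show ?thesis by blast
  qed
  then obtain F where F: "\<And>i. F i holomorphic_on UNIV" "\<And>i t. F i (of_real t) = g t $ i"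
    by metis
  define G where "G = (\<lambda>\<zeta>. \<chi> i. F i \<zeta>)"
  have Gt: "G (of_real t) = g t" for t
    by (simp add: G_def F vec_eq_iff)
  have "continuous_on UNIV G"
    unfolding G_def by (intro continuous_on_vec_lambda holomorphic_on_imp_continuous_on F)
  then have V: "open (G -` \<Omega>)"
    using op by (simp add: open_vimage)
  have seg: "closed_segment 0 1 \<subseteq> G -` \<Omega>"
  proof
    fix x :: complex assume "x \<in> closed_segment 0 1"
    then obtain u where "0 \<le> u" "u \<le> 1" "x = of_real u"
      by (auto simp: in_segment scaleR_conv_of_real)
    then show "x \<in> G -` \<Omega>"
      using gim Gt by (auto simp: path_image_def)
  qed
  obtain e where e: "e > 0" "(\<Union>x\<in>closed_segment 0 (1::complex). ball x e) \<subseteq> G -` \<Omega>"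
    using compact_subset_open_imp_ball_epsilon_subset[OF compact_segment V seg] by blast
  define W where "W = (\<Union>x\<in>closed_segment 0 (1::complex). ball x e)"
  have oW: "open W" by (auto simp: W_def)
  have "W = (\<Union>x\<in>closed_segment 0 (1::complex). \<Union>y\<in>ball 0 e. {x + y})"
  proof -
    have "ball x e = (\<Union>y\<in>ball 0 e. {x + y})" for x :: complex
    proof (intro equalityI subsetI)
      fix y assume "y \<in> ball x e"
      then have "y - x \<in> ball 0 e" "y = x + (y - x)"
        by (auto simp: dist_norm norm_minus_commute)
      then show "y \<in> (\<Union>y\<in>ball 0 e. {x + y})" by blast
    qed (auto simp: dist_norm)
    then show ?thesis unfolding W_def by (rule SUP_cong[OF refl])
  qed
  then have "convex W"
    using convex_sums[OF convex_closed_segment[of 0 1] convex_ball[of 0 e]] by simp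
  then have scW: "simply_connected W" by (rule convex_imp_simply_connected)
  have W01: "0 \<in> W" "1 \<in> W"
    using e(1) UN_I[of 0 "closed_segment 0 (1::complex)" 0 "\<lambda>x. ball x e"]
      UN_I[of 1 "closed_segment 0 (1::complex)" 1 "\<lambda>x. ball x e"] by (simp_all add: W_def)
  have "bounded W"
  proof (rule bounded_subset)
    show "bounded (cball (0::complex) (1 + e))" by simp
    show "W \<subseteq> cball 0 (1 + e)"
    proof
      fix y assume "y \<in> W"
      then obtain x :: complex where x: "x \<in> closed_segment 0 1" "dist x y < e"
        by (auto simp: W_def)
      then have "norm x \<le> 1"
        by (auto simp: in_segment)
      moreover have "norm y \<le> norm x + dist x y"
        by (metis dist_norm norm_minus_commute norm_triangle_sub)
      ultimately show "y \<in> cball 0 (1 + e)" using x(2) by simp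
    qed
  qed
  then have "W \<noteq> UNIV" using not_bounded_UNIV by auto
  then obtain f h where f: "\<forall>x\<in>W. f x \<in> ball 0 1 \<and> h (f x) = x"
    and h: "h holomorphic_on ball 0 1" "\<forall>x\<in>ball 0 1. h x \<in> W \<and> f (h x) = x"
    using iffD1[OF Riemann_mapping_theorem, of W] oW scW W01 by blast
  have f0: "f 0 \<in> ball 0 1" using f W01 by blast
  obtain u v where u0: "u (f 0) = 0"
    and "u holomorphic_on ball 0 1" and u: "u ` ball 0 1 \<subseteq> ball 0 1"
    and v: "v holomorphic_on ball 0 1" "v ` ball 0 1 \<subseteq> ball 0 1"
    and "\<And>x. x \<in> ball 0 1 \<Longrightarrow> u (v x) = x"
    and vu: "\<And>x. x \<in> ball 0 1 \<Longrightarrow> v (u x) = x"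
    by (rule ball_biholomorphism_exists[OF f0]) (rule that)
  define \<phi> where "\<phi> = G \<circ> h \<circ> v"
  have hv: "(h \<circ> v) holomorphic_on ball 0 1"
    using h(1) v by (intro holomorphic_on_compose) (auto intro: holomorphic_on_subset)
  have "(\<lambda>\<zeta>. \<phi> \<zeta> $ i) holomorphic_on ball 0 1" for i
  proof -
    have "(F i \<circ> (h \<circ> v)) holomorphic_on ball 0 1"
      by (intro holomorphic_on_compose hv holomorphic_on_subset[OF F(1)]) auto
    then show ?thesis by (simp add: \<phi>_def G_def o_def)
  qed
  moreover have "\<phi> ` ball 0 1 \<subseteq> \<Omega>"
  proof
    fix y assume "y \<in> \<phi> ` ball 0 1"
    then obtain x where x: "x \<in> ball 0 1" "y = G (h (v x))" by (auto simp: \<phi>_def)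
    then have "h (v x) \<in> W" using v(2) h(2) by blast
    then show "y \<in> \<Omega>" using e(2) x(2) unfolding W_def by blast
  qed
  moreover have "\<phi> 0 = z"
    using vu[of "f 0"] u0 f W01 Gt[of 0] g0 by (auto simp: \<phi>_def)
  moreover have "\<phi> (u (f 1)) = w"
    using vu[of "f 1"] f W01 Gt[of 1] g1 by (auto simp: \<phi>_def)
  moreover have "u (f 1) \<in> ball 0 1"
    using u f W01 by blast
  ultimately show ?thesis
    unfolding holo_discs_def by blast
qed

lemma lempert_tilde_bounds:
  assumes "is_domain \<Omega>" "z \<in> \<Omega>" "w \<in> \<Omega>"
  shows "0 \<le> lempert_tilde \<Omega> z w" "lempert_tilde \<Omega> z w < 1"
proof -
  let ?A = "{cmod \<alpha> | \<alpha>. \<alpha> \<in> ball 0 1 \<and> (\<exists>\<phi>\<in>holo_discs \<Omega>. \<phi> 0 = z \<and> \<phi> \<alpha> = w)}"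
  obtain \<alpha> where \<alpha>: "\<alpha> \<in> ball 0 1" "\<exists>\<phi>\<in>holo_discs \<Omega>. \<phi> 0 = z \<and> \<phi> \<alpha> = w"
    using lempert_set_nonempty[OF assms] by blast
  then have mem: "cmod \<alpha> \<in> ?A" by blast
  show "0 \<le> lempert_tilde \<Omega> z w"
    unfolding lempert_tilde_def using mem by (intro cInf_greatest) auto
  have "lempert_tilde \<Omega> z w \<le> cmod \<alpha>"
    unfolding lempert_tilde_def by (rule cInf_lower[OF mem]) (auto intro!: bdd_belowI[of _ 0])
  then show "lempert_tilde \<Omega> z w < 1" using \<alpha> by simp
qed

lemma lempert_nonneg:
  assumes "is_domain \<Omega>" "z \<in> \<Omega>" "w \<in> \<Omega>"
  shows "0 \<le> lempert \<Omega> z w"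
  using lempert_tilde_bounds[OF assms] by (simp add: lempert_def artanh_def)

lemma kobayashi_greatest:
  assumes "pseudodistance_on \<Omega> d" "\<forall>x\<in>\<Omega>. \<forall>y\<in>\<Omega>. d x y \<le> lempert \<Omega> x y" "z \<in> \<Omega>" "w \<in> \<Omega>"
  shows "d z w \<le> kobayashi \<Omega> z w"
  unfolding kobayashi_def
  by (rule cSup_upper) (use assms in \<open>auto intro!: bdd_aboveI[of _ "lempert \<Omega> z w"]\<close>)

lemma kobayashi_least:
  assumes "is_domain \<Omega>"
    and "\<And>d. pseudodistance_on \<Omega> d \<Longrightarrow> \<forall>x\<in>\<Omega>. \<forall>y\<in>\<Omega>. d x y \<le> lempert \<Omega> x y \<Longrightarrow> d z w \<le> c"
  shows "kobayashi \<Omega> z w \<le> c"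
  unfolding kobayashi_def
proof (rule cSup_least)
  have "pseudodistance_on \<Omega> (\<lambda>_ _. 0)" by (simp add: pseudodistance_on_def)
  then show "{d z w | d. pseudodistance_on \<Omega> d \<and> (\<forall>x\<in>\<Omega>. \<forall>y\<in>\<Omega>. d x y \<le> lempert \<Omega> x y)} \<noteq> {}"
    using lempert_nonneg[OF assms(1)] by fastforce
qed (use assms(2) in auto)

lemma kobayashi_le_lempert:
  assumes "is_domain \<Omega>" "z \<in> \<Omega>" "w \<in> \<Omega>"
  shows "kobayashi \<Omega> z w \<le> lempert \<Omega> z w"
  using assms by (intro kobayashi_least) auto

lemma pseudodistance_on_kobayashi:
  assumes "is_domain \<Omega>"
  shows "pseudodistance_on \<Omega> (kobayashi \<Omega>)"
proof -
  have nonneg: "0 \<le> kobayashi \<Omega> x y" if "x \<in> \<Omega>" "y \<in> \<Omega>" for x y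
    using kobayashi_greatest[of \<Omega> "\<lambda>_ _. 0" x y] that lempert_nonneg[OF assms]
    by (auto simp: pseudodistance_on_def)
  have le: "kobayashi \<Omega> x y \<le> kobayashi \<Omega> y x" if "x \<in> \<Omega>" "y \<in> \<Omega>" for x y
  proof (rule kobayashi_least[OF assms])
    fix d assume d: "pseudodistance_on \<Omega> d" "\<forall>x\<in>\<Omega>. \<forall>y\<in>\<Omega>. d x y \<le> lempert \<Omega> x y"
    then have "d x y = d y x" using that by (auto simp: pseudodistance_on_def)
    also have "\<dots> \<le> kobayashi \<Omega> y x" using kobayashi_greatest[OF d] that by blast
    finally show "d x y \<le> kobayashi \<Omega> y x" .
  qed
  have refl: "kobayashi \<Omega> x x = 0" if "x \<in> \<Omega>" for x
  proof (rule antisym)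
    show "kobayashi \<Omega> x x \<le> 0"
      by (rule kobayashi_least[OF assms]) (use that in \<open>auto simp: pseudodistance_on_def\<close>)
  qed (use nonneg that in auto)
  have tri: "kobayashi \<Omega> x z \<le> kobayashi \<Omega> x y + kobayashi \<Omega> y z"
    if "x \<in> \<Omega>" "y \<in> \<Omega>" "z \<in> \<Omega>" for x y z
  proof (rule kobayashi_least[OF assms])
    fix d assume d: "pseudodistance_on \<Omega> d" "\<forall>x\<in>\<Omega>. \<forall>y\<in>\<Omega>. d x y \<le> lempert \<Omega> x y"
    have "d x z \<le> d x y + d y z" using d(1) that by (auto simp: pseudodistance_on_def)
    also have "\<dots> \<le> kobayashi \<Omega> x y + kobayashi \<Omega> y z"
      using kobayashi_greatest[OF d] that by (intro add_mono) auto
    finally show "d x z \<le> kobayashi \<Omega> x y + kobayashi \<Omega> y z" .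
  qed
  show ?thesis
    unfolding pseudodistance_on_def using nonneg refl tri le by (meson antisym)
qed

end

theory Submission
  imports Defs
begin

text \<open>Almost minimizing chains of discs from \<open>z\<close> to \<open>w\<close> are localized one disc at a time. If the
  centre \<open>x\<close> of a disc has Kobayashi distance at least \<open>R\<close> from the complement of \<open>U\<close>, shrinking the
  disc by \<open>tanh R\<close> puts it into \<open>\<Omega> \<inter> U\<close> (Royden), so a short step becomes longer by a factor
  \<open>1 + O(exp (-2R))\<close>. The weak Gromov property bounds \<open>R\<close> below by the distance from \<open>x\<close> to a base
  point \<open>o'\<close> up to a constant, for \<open>x\<close> near \<open>p\<close>. As \<open>p\<close> is a \<open>w\<close>-point, the whole chain stays near
  \<open>p\<close>, and its points are at distance at least \<open>G + \<bar>t - t0\<bar>\<close> from \<open>o'\<close>, where \<open>G\<close> is essentially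
  the Gromov product of \<open>z\<close> and \<open>w\<close>, \<open>t\<close> is the time along the chain and \<open>t0\<close> is a fixed time.
  Summed over the chain, the error is
  \<open>O(exp (-2G))\<close>, and \<open>G\<close> tends to infinity.\<close>

section \<open>Discs joining two points\<close>

lemma tanh_artanh_real:
  fixes u :: real
  assumes "\<bar>u\<bar> < 1"
  shows "tanh (artanh u) = u"
proof -
  have pos: "0 < 1 + u" "0 < 1 - u" using assms by auto
  have "exp (- 2 * artanh u) = exp (- ln ((1 + u) / (1 - u)))"
    by (simp add: artanh_def)
  also have "\<dots> = (1 - u) / (1 + u)"
    using pos by (simp add: exp_minus)
  finally show ?thesis
    using pos by (simp only: tanh_real_altdef) (simp add: field_simps)
qed

lemma holo_discs_compose:
  assumes "\<phi> \<in> holo_discs \<Omega>" "\<psi> holomorphic_on ball 0 1" "\<psi> ` ball 0 1 \<subseteq> ball 0 1"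
  shows "\<phi> \<circ> \<psi> \<in> holo_discs \<Omega>"
proof -
  have "((\<lambda>\<zeta>. \<phi> \<zeta> $ i) \<circ> \<psi>) holomorphic_on ball 0 1" for i
    using assms unfolding holo_discs_def
    by (intro holomorphic_on_compose holomorphic_on_subset[OF _ assms(3)]) auto
  then show ?thesis
    using assms unfolding holo_discs_def by (fastforce simp: o_def)
qed

text \<open>\<open>s\<close> is the Poincare distance from \<open>0\<close> to
  \<open>tanh s\<close>, so \<open>lempert\<close> is the infimum of the admissible
  \<open>s\<close>. The second parameter is put on the real diameter, a geodesic along which such
  lengths add up.\<close>

definition disc_step ::
  "(complex ^ 'n) set \<Rightarrow> complex ^ 'n \<Rightarrow> complex ^ 'n \<Rightarrow> real \<Rightarrow> bool" where
  "disc_step \<Omega> x y s \<longleftrightarrow>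
     0 \<le> s \<and> (\<exists>\<phi>\<in>holo_discs \<Omega>. \<phi> 0 = x \<and> \<phi> (of_real (tanh s)) = y)"

lemma tanh_in_ball: "complex_of_real (tanh s) \<in> ball 0 1"
  using tanh_real_bounds[of s] by (simp add: abs_less_iff)

lemma disc_step_in:
  assumes "disc_step \<Omega> x y s"
  shows "x \<in> \<Omega>" "y \<in> \<Omega>" "0 \<le> s"
  using assms tanh_in_ball[of s] by (auto simp: disc_step_def holo_discs_def)

lemma disc_step_of_disc:
  assumes "\<phi> \<in> holo_discs \<Omega>" "\<alpha> \<in> ball 0 1"
  shows "disc_step \<Omega> (\<phi> 0) (\<phi> \<alpha>) (artanh (cmod \<alpha>))"
proof -
  \<comment> \<open>A rotation brings the parameter to the real axis. For
    \<open>\<alpha> = 0\<close> the value \<open>sgn \<alpha> = 0\<close> makes the disc constant,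
    which is all that a step of length \<open>0\<close> needs.\<close>
  let ?\<psi> = "\<lambda>\<zeta>. \<zeta> * sgn \<alpha>"
  have "\<phi> \<circ> ?\<psi> \<in> holo_discs \<Omega>"
  proof (rule holo_discs_compose[OF assms(1)])
    show "?\<psi> holomorphic_on ball 0 1" by (intro holomorphic_intros)
    have "cmod (?\<psi> \<zeta>) \<le> cmod \<zeta>" for \<zeta>
      by (simp add: norm_mult norm_sgn)
    then show "?\<psi> ` ball 0 1 \<subseteq> ball 0 1" by (force intro: le_less_trans)
  qed
  moreover have "complex_of_real (cmod \<alpha>) * sgn \<alpha> = \<alpha>"
    by (cases "\<alpha> = 0") (auto simp: sgn_eq)
  moreover have "tanh (artanh (cmod \<alpha>)) = cmod \<alpha>"
    using assms(2) by (intro tanh_artanh_real) auto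
  moreover from this have "0 \<le> artanh (cmod \<alpha>)"
    by (metis norm_ge_zero tanh_real_nonneg_iff)
  ultimately show ?thesis
    unfolding disc_step_def by (intro conjI bexI[of _ "\<phi> \<circ> ?\<psi>"]) auto
qed

text \<open>The automorphism of the unit disc that takes \<open>0\<close> to \<open>tanh a\<close>
  takes \<open>tanh (b - a)\<close> to \<open>tanh b\<close>, by the addition theorem for
  \<open>tanh\<close>.\<close>

lemma disc_step_between:
  assumes \<phi>: "\<phi> \<in> holo_discs \<Omega>" and "a \<le> b"
  shows "disc_step \<Omega> (\<phi> (of_real (tanh a))) (\<phi> (of_real (tanh b))) (b - a)"
proof -
  define w where "w = - complex_of_real (tanh a)"
  have w: "norm w < 1" using tanh_in_ball[of a] by (simp add: w_def)
  let ?\<psi> = "Moebius_function 0 w"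
  have "\<phi> \<circ> ?\<psi> \<in> holo_discs \<Omega>"
    using Moebius_function_norm_lt_1[OF w]
    by (intro holo_discs_compose[OF \<phi>] Moebius_function_holomorphic[OF w]) auto
  moreover have "?\<psi> 0 = of_real (tanh a)"
    by (simp add: Moebius_function_simple w_def)
  moreover have "?\<psi> (of_real (tanh (b - a))) = of_real (tanh b)"
  proof -
    have "tanh b = (tanh (b - a) + tanh a) / (1 + tanh (b - a) * tanh a)"
      using tanh_add[of "b - a" a] by simp
    then have "complex_of_real (tanh b) =
        complex_of_real ((tanh (b - a) + tanh a) / (1 + tanh (b - a) * tanh a))"
      by simp
    then show ?thesis
      by (simp only: Moebius_function_simple w_def of_real_divide of_real_add of_real_mult of_real_1)
         (simp add: mult.commute)
  qed
  ultimately show ?thesis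
    using \<open>a \<le> b\<close> unfolding disc_step_def by (intro conjI bexI[of _ "\<phi> \<circ> ?\<psi>"]) auto
qed

text \<open>Precomposing with \<open>uminus\<close> turns the segment from \<open>0\<close> to
  \<open>tanh s\<close> into one from \<open>tanh (-s)\<close> to \<open>0\<close>, which is run
  through from \<open>y\<close> to \<open>x\<close>.\<close>

lemma disc_step_commute:
  assumes "disc_step \<Omega> x y s"
  shows "disc_step \<Omega> y x s"
proof -
  obtain \<phi> where \<phi>: "0 \<le> s" "\<phi> \<in> holo_discs \<Omega>" "\<phi> 0 = x" "\<phi> (of_real (tanh s)) = y"
    using assms by (auto simp: disc_step_def)
  have "\<phi> \<circ> uminus \<in> holo_discs \<Omega>"
    by (rule holo_discs_compose[OF \<phi>(2)]) (auto intro!: holomorphic_intros)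
  from disc_step_between[OF this, of "-s" 0] \<phi> show ?thesis by simp
qed

lemma disc_step_split:
  assumes "disc_step \<Omega> x y s" "0 \<le> r" "r \<le> s"
  obtains m where "disc_step \<Omega> x m r" "disc_step \<Omega> m y (s - r)"
proof -
  obtain \<phi> where \<phi>: "\<phi> \<in> holo_discs \<Omega>" "\<phi> 0 = x" "\<phi> (of_real (tanh s)) = y"
    using assms by (auto simp: disc_step_def)
  show thesis
    using that disc_step_between[OF \<phi>(1) assms(2)] disc_step_between[OF \<phi>(1) assms(3)] \<phi>
    by simp
qed

lemma kobayashi_le_disc_step:
  assumes "is_domain \<Omega>" "disc_step \<Omega> x y s"
  shows "kobayashi \<Omega> x y \<le> s"
proof -
  note xy = disc_step_in[OF assms(2)]
  obtain \<phi> where \<phi>: "\<phi> \<in> holo_discs \<Omega>" "\<phi> 0 = x" "\<phi> (of_real (tanh s)) = y"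
    using assms(2) by (auto simp: disc_step_def)
  have "cmod (of_real (tanh s)) = tanh s" using xy by simp
  then have "lempert_tilde \<Omega> x y \<le> tanh s"
    unfolding lempert_tilde_def using \<phi> tanh_in_ball[of s]
    by (intro cInf_lower bdd_belowI[of _ 0] CollectI exI[of _ "of_real (tanh s)"]) auto
  moreover have "tanh (lempert \<Omega> x y) = lempert_tilde \<Omega> x y"
    using lempert_tilde_bounds[OF assms(1) xy(1,2)] unfolding lempert_def
    by (intro tanh_artanh_real) auto
  ultimately have "lempert \<Omega> x y \<le> s" by (metis tanh_real_le_iff)
  then show ?thesis using kobayashi_le_lempert[OF assms(1) xy(1,2)] by simp
qed

text \<open>The infimum in \<open>lempert\<close> need not be attained, so a disc realizes it only
  up to an arbitrarily small excess.\<close>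

lemma disc_step_less:
  assumes "is_domain \<Omega>" "x \<in> \<Omega>" "y \<in> \<Omega>" "lempert \<Omega> x y < c"
  obtains s where "s < c" "disc_step \<Omega> x y s"
proof -
  let ?A = "{cmod \<alpha> | \<alpha>. \<alpha> \<in> ball 0 1 \<and> (\<exists>\<phi>\<in>holo_discs \<Omega>. \<phi> 0 = x \<and> \<phi> \<alpha> = y)}"
  have "tanh (lempert \<Omega> x y) = lempert_tilde \<Omega> x y"
    using lempert_tilde_bounds[OF assms(1-3)] unfolding lempert_def
    by (intro tanh_artanh_real) auto
  then have "lempert_tilde \<Omega> x y < tanh c" using assms(4) by (metis tanh_real_less_iff)
  then have "Inf ?A < tanh c" by (simp only: lempert_tilde_def)
  moreover have "?A \<noteq> {}"
    using lempert_set_nonempty[OF assms(1-3)] by blast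
  ultimately have "\<exists>a\<in>?A. a < tanh c" by (intro cInf_lessD)
  then obtain \<alpha> \<phi> where \<alpha>: "cmod \<alpha> < tanh c" "\<alpha> \<in> ball 0 1"
    "\<phi> \<in> holo_discs \<Omega>" "\<phi> 0 = x" "\<phi> \<alpha> = y"
    by blast
  have "tanh (artanh (cmod \<alpha>)) = cmod \<alpha>"
    using \<alpha>(2) by (intro tanh_artanh_real) auto
  then have "artanh (cmod \<alpha>) < c" using \<alpha>(1) by (metis tanh_real_less_iff)
  then show thesis using that disc_step_of_disc[OF \<alpha>(3,2)] \<alpha>(4,5) by auto
qed

lemma disc_step_exists:
  assumes "is_domain \<Omega>" "x \<in> \<Omega>" "y \<in> \<Omega>"
  obtains s where "disc_step \<Omega> x y s"
  using disc_step_less[OF assms, of "lempert \<Omega> x y + 1"] by auto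

lemma disc_step_mono:
  assumes "disc_step D x y s" "D \<subseteq> \<Omega>"
  shows "disc_step \<Omega> x y s"
  using assms unfolding disc_step_def holo_discs_def by blast

section \<open>Metric properties and monotonicity of the Kobayashi distance\<close>

lemma kobayashi_nonneg:
  assumes "is_domain \<Omega>" "x \<in> \<Omega>" "y \<in> \<Omega>"
  shows "0 \<le> kobayashi \<Omega> x y"
  using pseudodistance_on_kobayashi[OF assms(1)] assms by (auto simp: pseudodistance_on_def)

lemma kobayashi_refl:
  assumes "is_domain \<Omega>" "x \<in> \<Omega>"
  shows "kobayashi \<Omega> x x = 0"
  using pseudodistance_on_kobayashi[OF assms(1)] assms by (auto simp: pseudodistance_on_def)

lemma kobayashi_commute:
  assumes "is_domain \<Omega>" "x \<in> \<Omega>" "y \<in> \<Omega>"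
  shows "kobayashi \<Omega> x y = kobayashi \<Omega> y x"
  using pseudodistance_on_kobayashi[OF assms(1)] assms by (auto simp: pseudodistance_on_def)

lemma kobayashi_triangle:
  assumes "is_domain \<Omega>" "x \<in> \<Omega>" "y \<in> \<Omega>" "z \<in> \<Omega>"
  shows "kobayashi \<Omega> x z \<le> kobayashi \<Omega> x y + kobayashi \<Omega> y z"
  using pseudodistance_on_kobayashi[OF assms(1)] assms by (auto simp: pseudodistance_on_def)

text \<open>Discs in \<open>D\<close> are discs in \<open>\<Omega>\<close>, so the distance of
  \<open>\<Omega>\<close> restricted to \<open>D\<close> competes in the supremum that defines the
  distance of \<open>D\<close>.\<close>

lemma kobayashi_mono:
  assumes "is_domain \<Omega>" "is_domain D" "D \<subseteq> \<Omega>" "x \<in> D" "y \<in> D"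
  shows "kobayashi \<Omega> x y \<le> kobayashi D x y"
proof (rule kobayashi_greatest[OF _ _ assms(4,5)])
  show "pseudodistance_on D (kobayashi \<Omega>)"
    using pseudodistance_on_kobayashi[OF assms(1)] assms(3)
    unfolding pseudodistance_on_def by blast
  show "\<forall>x\<in>D. \<forall>y\<in>D. kobayashi \<Omega> x y \<le> lempert D x y"
  proof (intro ballI, rule dense_ge)
    fix x y c assume "x \<in> D" "y \<in> D" "lempert D x y < c"
    then obtain s where "s < c" "disc_step D x y s"
      using disc_step_less[OF assms(2)] by metis
    then show "kobayashi \<Omega> x y \<le> c"
      using kobayashi_le_disc_step[OF assms(1) disc_step_mono[OF _ assms(3)]] by fastforce
  qed
qed

section \<open>The Kobayashi distance as an infimum over fine chains of discs\<close>

text \<open>The last argument is the total length. The bound \<open>\<delta>\<close> on single steps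
  makes the errors quadratic in the step length, \<open>4 * s * s\<close>, sum to at most
  \<open>4 * \<delta>\<close> times the length.\<close>

inductive fine_chain ::
  "(complex ^ 'n) set \<Rightarrow> real \<Rightarrow> complex ^ 'n \<Rightarrow> complex ^ 'n \<Rightarrow> real \<Rightarrow> bool"
  for \<Omega> \<delta> where
  nil: "x \<in> \<Omega> \<Longrightarrow> fine_chain \<Omega> \<delta> x x 0"
| cons: "disc_step \<Omega> x y s \<Longrightarrow> s \<le> \<delta> \<Longrightarrow> fine_chain \<Omega> \<delta> y w t \<Longrightarrow> fine_chain \<Omega> \<delta> x w (s + t)"

lemma fine_chain_in:
  assumes "fine_chain \<Omega> \<delta> x w t"
  shows "x \<in> \<Omega> \<and> w \<in> \<Omega> \<and> 0 \<le> t"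
  using assms by induction (auto dest: disc_step_in)

lemma fine_chain_trans:
  assumes "fine_chain \<Omega> \<delta> x y s" "fine_chain \<Omega> \<delta> y w t"
  shows "fine_chain \<Omega> \<delta> x w (s + t)"
  using assms by induction (auto intro: fine_chain.intros simp: add.assoc)

lemma fine_chain_single:
  assumes "disc_step \<Omega> x y s" "s \<le> \<delta>"
  shows "fine_chain \<Omega> \<delta> x y s"
  using fine_chain.cons[OF assms fine_chain.nil] disc_step_in[OF assms(1)] by simp

lemma fine_chain_commute:
  assumes "fine_chain \<Omega> \<delta> x y t"
  shows "fine_chain \<Omega> \<delta> y x t"
  using assms
proof induction
  case (cons x y s w t)
  then show ?case
    using fine_chain_trans[OF cons.IH fine_chain_single[OF disc_step_commute]]
    by (simp add: add.commute)
qed (rule fine_chain.nil)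

lemma kobayashi_le_fine_chain:
  assumes "is_domain \<Omega>" "fine_chain \<Omega> \<delta> x w t"
  shows "kobayashi \<Omega> x w \<le> t"
  using assms(2)
proof induction
  case (cons x y s w t)
  then show ?case
    using kobayashi_triangle[OF assms(1), of x y w] kobayashi_le_disc_step[OF assms(1) cons.hyps(1)]
      disc_step_in[OF cons.hyps(1)] fine_chain_in[OF cons.hyps(3)] by auto
qed (simp add: kobayashi_refl[OF assms(1)])

text \<open>Pieces of length \<open>\<delta>\<close> are cut off along the real diameter; refining a
  disc costs no length.\<close>

lemma fine_chain_disc_step:
  assumes "disc_step \<Omega> x y s" "0 < \<delta>"
  shows "fine_chain \<Omega> \<delta> x y s"
proof -
  obtain n where "s \<le> real n * \<delta>"
    using reals_Archimedean3[OF assms(2)] by (meson less_imp_le)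
  then show ?thesis using assms(1)
  proof (induction n arbitrary: x s)
    case 0
    then show ?case
      using fine_chain_single assms(2) by (metis less_imp_le mult_zero_left of_nat_0 order_trans)
  next
    case (Suc n)
    show ?case
    proof (cases "s \<le> \<delta>")
      case True
      then show ?thesis using fine_chain_single Suc.prems by blast
    next
      case False
      then obtain m where m: "disc_step \<Omega> x m \<delta>" "disc_step \<Omega> m y (s - \<delta>)"
        using disc_step_split[OF Suc.prems(2), of \<delta>] assms(2) by auto
      have "s - \<delta> \<le> real n * \<delta>" using Suc.prems(1) by (simp add: algebra_simps)
      from fine_chain.cons[OF m(1) order_refl Suc.IH[OF this m(2)]] show ?thesis by simp
    qed
  qed
qed

text \<open>The infimum of the chain lengths is a pseudodistance, by concatenation and reversal of
  chains, and lies below \<open>lempert\<close> because a disc can be subdivided at no cost.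
  Maximality of the Kobayashi distance then bounds it, whatever the mesh \<open>\<delta>\<close>
  is.\<close>

lemma fine_chain_less:
  assumes \<Omega>: "is_domain \<Omega>" and xy: "x \<in> \<Omega>" "y \<in> \<Omega>" and \<delta>: "0 < \<delta>" and c: "kobayashi \<Omega> x y < c"
  obtains t where "t < c" "fine_chain \<Omega> \<delta> x y t"
proof -
  define d where "d = (\<lambda>x y. Inf {t. fine_chain \<Omega> \<delta> x y t})"
  have ne: "{t. fine_chain \<Omega> \<delta> x y t} \<noteq> {}" if "x \<in> \<Omega>" "y \<in> \<Omega>" for x y
    using disc_step_exists[OF \<Omega> that] fine_chain_disc_step \<delta> by (metis Collect_empty_eq)
  have bdd: "bdd_below {t. fine_chain \<Omega> \<delta> x y t}" for x y
    by (rule bdd_belowI[of _ 0]) (auto dest: fine_chain_in)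
  have le: "d x y \<le> t" if "fine_chain \<Omega> \<delta> x y t" for x y t
    unfolding d_def by (rule cInf_lower[OF _ bdd]) (use that in auto)
  have approx: "\<exists>t<c. fine_chain \<Omega> \<delta> x y t" if "x \<in> \<Omega>" "y \<in> \<Omega>" "d x y < c" for x y c
    using cInf_lessD[OF ne[OF that(1,2)]] that(3) unfolding d_def by auto
  have nonneg: "0 \<le> d x y" if "x \<in> \<Omega>" "y \<in> \<Omega>" for x y
    unfolding d_def by (rule cInf_greatest[OF ne[OF that]]) (auto dest: fine_chain_in)
  have tri: "d x z \<le> d x y + d y z" if xyz: "x \<in> \<Omega>" "y \<in> \<Omega>" "z \<in> \<Omega>" for x y z
  proof (rule field_le_epsilon)
    fix e :: real assume "0 < e"
    then have "d x y < d x y + e / 2" "d y z < d y z + e / 2" by simp_all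
    then obtain s t where s: "s < d x y + e / 2" "fine_chain \<Omega> \<delta> x y s"
        and t: "t < d y z + e / 2" "fine_chain \<Omega> \<delta> y z t"
      using approx[OF xyz(1,2)] approx[OF xyz(2,3)] by meson
    then show "d x z \<le> d x y + d y z + e"
      using le[OF fine_chain_trans[OF s(2) t(2)]] by linarith
  qed
  have "pseudodistance_on \<Omega> d"
    unfolding pseudodistance_on_def
  proof (intro conjI ballI)
    show "d x x = 0" if "x \<in> \<Omega>" for x
      using le[OF fine_chain.nil[OF that]] nonneg[OF that that] by simp
    show "d x y = d y x" for x y
    proof -
      have "{t. fine_chain \<Omega> \<delta> x y t} = {t. fine_chain \<Omega> \<delta> y x t}"
        using fine_chain_commute by blast
      then show ?thesis by (simp only: d_def)
    qed
  qed (use nonneg tri in auto)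
  moreover have "\<forall>x\<in>\<Omega>. \<forall>y\<in>\<Omega>. d x y \<le> lempert \<Omega> x y"
  proof (intro ballI, rule dense_ge)
    fix x y c assume "x \<in> \<Omega>" "y \<in> \<Omega>" "lempert \<Omega> x y < c"
    then obtain s where "s < c" "disc_step \<Omega> x y s"
      using disc_step_less[OF \<Omega>] by metis
    then show "d x y \<le> c" using le[OF fine_chain_disc_step[OF _ \<delta>]] by fastforce
  qed
  ultimately have "d x y \<le> kobayashi \<Omega> x y" using kobayashi_greatest xy by blast
  then have "d x y < c" using c by simp
  then show thesis using approx[OF xy] that by blast
qed

section \<open>Local bounds and the crossing of spheres\<close>

lemma norm_vector_scalar_mult:
  fixes v :: "complex ^ 'n"
  shows "norm (c *s v) = cmod c * norm v"
  by (simp add: norm_vec_def norm_mult L2_set_right_distrib)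

lemma kobayashi_locally_bounded:
  fixes q :: "complex ^ 'n"
  assumes "is_domain \<Omega>" "ball q r \<subseteq> \<Omega>" "dist q u < r / 2"
  shows "kobayashi \<Omega> q u \<le> artanh (1 / 2)"
proof -
  \<comment> \<open>The affine disc centred at \<open>q\<close> that meets \<open>u\<close> at
    parameter \<open>1 / 2\<close>.\<close>
  define \<phi> where "\<phi> = (\<lambda>\<zeta>::complex. q + (2 * \<zeta>) *s (u - q))"
  have small: "norm (u - q) < r / 2" using assms(3) by (simp add: dist_norm norm_minus_commute)
  have "\<phi> \<zeta> \<in> \<Omega>" if "\<zeta> \<in> ball 0 1" for \<zeta>
  proof -
    have "dist q (\<phi> \<zeta>) = 2 * cmod \<zeta> * norm (u - q)"
      by (simp add: \<phi>_def dist_norm norm_vector_scalar_mult norm_mult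
          del: vector_sub_rdistrib vector_ssub_ldistrib)
    also have "\<dots> \<le> 2 * 1 * norm (u - q)"
      using that by (intro mult_right_mono mult_left_mono) auto
    finally show ?thesis using small assms(2) by auto
  qed
  moreover have "(\<lambda>\<zeta>. \<phi> \<zeta> $ i) holomorphic_on ball 0 1" for i
    unfolding \<phi>_def by (auto intro!: holomorphic_intros)
  ultimately have "\<phi> \<in> holo_discs \<Omega>" by (auto simp: holo_discs_def)
  from disc_step_of_disc[OF this, of "1/2"]
  have "disc_step \<Omega> q u (artanh (1 / 2))" by (simp add: \<phi>_def norm_divide)
  then show ?thesis by (rule kobayashi_le_disc_step[OF assms(1)])
qed

lemma holo_discs_continuous:
  assumes "\<phi> \<in> holo_discs \<Omega>"
  shows "continuous_on (ball 0 1) \<phi>"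
proof -
  have "continuous_on (ball 0 1) (\<lambda>\<zeta>. \<chi> i. \<phi> \<zeta> $ i)"
    using assms unfolding holo_discs_def
    by (intro continuous_on_vec_lambda holomorphic_on_imp_continuous_on) auto
  then show ?thesis by simp
qed

text \<open>The real segments of the discs form a path from \<open>x\<close> to \<open>u\<close>.
  The intermediate value theorem on the first step that leaves the ball gives the crossing point,
  and the length used up so far bounds its distance from \<open>x\<close>.\<close>

lemma fine_chain_crosses_sphere:
  assumes "is_domain \<Omega>" "fine_chain \<Omega> \<delta> x u t" "dist p x < r" "r \<le> dist p u"
  shows "\<exists>y\<in>\<Omega>. dist p y = r \<and> kobayashi \<Omega> x y \<le> t"
  using assms(2-)
proof induction
  case (cons x y s w t)
  note step = disc_step_in[OF cons.hyps(1)]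
  have t: "0 \<le> t" using fine_chain_in[OF cons.hyps(3)] by simp
  show ?case
  proof (cases "dist p y < r")
    case True
    then obtain v where v: "v \<in> \<Omega>" "dist p v = r" "kobayashi \<Omega> y v \<le> t"
      using cons.IH cons.prems(2) by blast
    have "kobayashi \<Omega> x v \<le> s + t"
      using kobayashi_triangle[OF assms(1) step(1,2) v(1)] v(3)
        kobayashi_le_disc_step[OF assms(1) cons.hyps(1)] by linarith
    then show ?thesis using v by blast
  next
    case False
    obtain \<phi> where \<phi>: "\<phi> \<in> holo_discs \<Omega>" "\<phi> 0 = x" "\<phi> (of_real (tanh s)) = y"
      using cons.hyps(1) by (auto simp: disc_step_def)
    have "continuous_on {0..s} (\<lambda>h. \<phi> (of_real (tanh h)))"
      by (rule continuous_on_compose2[OF holo_discs_continuous[OF \<phi>(1)]])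
        (auto intro!: continuous_intros
          simp: tanh_real_lt_1 abs_less_iff minus_less_iff tanh_real_gt_neg1)
    then have "continuous_on {0..s} (\<lambda>h. dist p (\<phi> (of_real (tanh h))))"
      by (intro continuous_intros)
    then obtain h where h: "0 \<le> h" "h \<le> s" "dist p (\<phi> (of_real (tanh h))) = r"
      using IVT'[of "\<lambda>h. dist p (\<phi> (of_real (tanh h)))" 0 r s] \<phi> False cons.prems(1) step(3)
      by auto
    have *: "disc_step \<Omega> x (\<phi> (of_real (tanh h))) h"
      using disc_step_between[OF \<phi>(1) h(1)] \<phi>(2) by simp
    show ?thesis
      using kobayashi_le_disc_step[OF assms(1) *] disc_step_in[OF *] h t
      by (intro bexI[of _ "\<phi> (of_real (tanh h))"]) auto
  qed
qed auto

section \<open>Localization along a single disc\<close>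

text \<open>Points of the disc with parameter of modulus below \<open>tanh R\<close> are closer to
  \<open>x\<close> than \<open>R\<close>, hence lie in \<open>U\<close>; connectedness keeps them in
  the component of \<open>x\<close>. Rescaling moves the parameter of \<open>y\<close> to
  \<open>tanh s / tanh R\<close>, which \<open>s < R\<close> keeps below \<open>1\<close>.\<close>

lemma disc_step_localize:
  assumes \<Omega>: "is_domain \<Omega>" and step: "disc_step \<Omega> x y s" and x: "x \<in> U" and s: "s < R"
    and R: "\<And>u. u \<in> \<Omega> - U \<Longrightarrow> R \<le> kobayashi \<Omega> x u"
  shows "disc_step (connected_component_set (\<Omega> \<inter> U) x) x y (artanh (tanh s / tanh R))"
proof -
  obtain \<phi> where \<phi>: "\<phi> \<in> holo_discs \<Omega>" "\<phi> 0 = x" "\<phi> (of_real (tanh s)) = y"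
    using step by (auto simp: disc_step_def)
  have s0: "0 \<le> s" using disc_step_in[OF step] by simp
  define \<rho> where "\<rho> = tanh R"
  have \<rho>: "0 < \<rho>" "\<rho> < 1" "tanh s < \<rho>"
    using s s0 tanh_real_lt_1[of R] by (auto simp: \<rho>_def)
  let ?D = "connected_component_set (\<Omega> \<inter> U) x"
  let ?\<psi> = "\<lambda>\<zeta>. complex_of_real \<rho> * \<zeta>"
  have norm\<psi>: "cmod (?\<psi> \<zeta>) < \<rho>" if "\<zeta> \<in> ball 0 1" for \<zeta>
    using that \<rho> by (simp add: norm_mult)
  have "?\<psi> ` ball 0 1 \<subseteq> ball 0 1" using norm\<psi> \<rho> by fastforce
  then have comp: "\<phi> \<circ> ?\<psi> \<in> holo_discs \<Omega>"
    by (intro holo_discs_compose[OF \<phi>(1)] holomorphic_intros)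
  have "(\<phi> \<circ> ?\<psi>) \<zeta> \<in> U" if \<zeta>: "\<zeta> \<in> ball 0 1" for \<zeta>
  proof (rule ccontr)
    assume notin: "(\<phi> \<circ> ?\<psi>) \<zeta> \<notin> U"
    have *: "disc_step \<Omega> x (\<phi> (?\<psi> \<zeta>)) (artanh (cmod (?\<psi> \<zeta>)))"
      using disc_step_of_disc[OF \<phi>(1), of "?\<psi> \<zeta>"] norm\<psi>[OF \<zeta>] \<rho>(2) \<phi>(2) by simp
    have "tanh (artanh (cmod (?\<psi> \<zeta>))) < tanh R"
      using norm\<psi>[OF \<zeta>] \<rho> by (subst tanh_artanh_real) (auto simp: \<rho>_def)
    moreover have "R \<le> kobayashi \<Omega> x (\<phi> (?\<psi> \<zeta>))"
      using R disc_step_in[OF *] notin by simp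
    ultimately show False
      using kobayashi_le_disc_step[OF \<Omega> *] by (simp only: tanh_real_less_iff)
  qed
  then have sub: "(\<phi> \<circ> ?\<psi>) ` ball 0 1 \<subseteq> \<Omega> \<inter> U"
    using comp by (auto simp: holo_discs_def)
  have "(\<phi> \<circ> ?\<psi>) ` ball 0 1 \<subseteq> ?D"
  proof (rule connected_component_maximal[OF _ _ sub])
    show "x \<in> (\<phi> \<circ> ?\<psi>) ` ball 0 1" using \<phi>(2) by (intro image_eqI[of _ _ 0]) auto
    show "connected ((\<phi> \<circ> ?\<psi>) ` ball 0 1)"
      by (intro connected_continuous_image holo_discs_continuous[OF comp] connected_ball)
  qed
  then have D: "\<phi> \<circ> ?\<psi> \<in> holo_discs ?D"
    using comp by (simp add: holo_discs_def)
  have q: "0 \<le> tanh s / \<rho>" "tanh s / \<rho> < 1" using \<rho> s0 by auto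
  have "complex_of_real (tanh s / \<rho>) \<in> ball 0 1" using q by (simp del: of_real_divide)
  from disc_step_of_disc[OF D this]
  show ?thesis using q \<phi> \<rho> s0 by (simp add: \<rho>_def norm_divide)
qed

section \<open>Estimates for \<open>tanh\<close> and \<open>artanh\<close>\<close>

lemma tanh_diff_mean_value:
  fixes s \<tau> :: real
  assumes "0 < s"
  obtains \<xi> where "\<tau> - s < \<xi>" "\<xi> < \<tau>" "tanh \<tau> - tanh (\<tau> - s) = s * (1 - tanh \<xi> ^ 2)"
proof -
  have "\<exists>\<xi>>\<tau> - s. \<xi> < \<tau> \<and> tanh \<tau> - tanh (\<tau> - s) = (\<tau> - (\<tau> - s)) * (1 - tanh \<xi> ^ 2)"
    using assms by (intro MVT2) (auto intro!: derivative_eq_intros)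
  then show thesis using that by auto
qed

lemma tanh_le_self:
  fixes s :: real
  assumes "0 \<le> s"
  shows "tanh s \<le> s"
proof (cases "s = 0")
  case False
  then obtain \<xi> where "tanh s - tanh (s - s) = s * (1 - tanh \<xi> ^ 2)"
    using tanh_diff_mean_value[of s s] assms by auto
  moreover have "s * (1 - tanh \<xi> ^ 2) \<le> s * 1"
    using assms by (intro mult_left_mono) auto
  ultimately show ?thesis by simp
qed simp

lemma exp_minus_abs_le_sech2:
  fixes \<xi> :: real
  shows "exp (- 2 * \<bar>\<xi>\<bar>) \<le> 1 - tanh \<xi> ^ 2"
proof -
  have "cosh \<xi> \<le> exp \<bar>\<xi>\<bar>"
    by (cases "0 \<le> \<xi>") (auto simp: cosh_def)
  then have "cosh \<xi> ^ 2 \<le> exp \<bar>\<xi>\<bar> ^ 2"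
    by (intro power_mono) auto
  then have "inverse (exp \<bar>\<xi>\<bar> ^ 2) \<le> inverse (cosh \<xi> ^ 2)"
    by (intro le_imp_inverse_le) auto
  moreover have "1 - tanh \<xi> ^ 2 = inverse (cosh \<xi> ^ 2)"
  proof -
    have "1 + sinh \<xi> ^ 2 \<noteq> 0" by (smt (verit) zero_le_power2)
    then show ?thesis by (simp add: tanh_def power_divide cosh_square_eq divide_simps)
  qed
  moreover have "exp (- 2 * \<bar>\<xi>\<bar>) = inverse (exp \<bar>\<xi>\<bar> ^ 2)"
    by (simp add: exp_minus exp_double)
  ultimately show ?thesis by simp
qed

text \<open>The derivative \<open>1 - tanh \<xi> ^ 2\<close> of \<open>tanh\<close> dominates
  \<open>exp (- 2 * \<bar>\<xi>\<bar>)\<close>. Bounding by increments lets the sum over a chain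
  telescope.\<close>

lemma exp_le_tanh_increment:
  fixes s \<tau> :: real
  assumes "0 \<le> s" "s \<le> 1 / 4"
  shows "s * exp (- 2 * \<bar>\<tau>\<bar>) \<le> 2 * (tanh \<tau> - tanh (\<tau> - s))"
proof (cases "s = 0")
  case False
  then obtain \<xi> where \<xi>: "\<tau> - s < \<xi>" "\<xi> < \<tau>" "tanh \<tau> - tanh (\<tau> - s) = s * (1 - tanh \<xi> ^ 2)"
    using tanh_diff_mean_value[of s \<tau>] assms by auto
  \<comment> \<open>\<open>\<xi>\<close> is within \<open>1 / 4\<close> of \<open>\<tau>\<close>, so
    the exponent changes by at most \<open>1 / 2\<close>.\<close>
  have "exp (- 2 * \<bar>\<tau>\<bar>) \<le> exp (1 / 2 + - 2 * \<bar>\<xi>\<bar>)"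
    using \<xi>(1,2) assms by simp
  also have "\<dots> = exp (1 / 2) * exp (- 2 * \<bar>\<xi>\<bar>)" by (rule exp_add)
  also have "\<dots> \<le> 2 * exp (- 2 * \<bar>\<xi>\<bar>)"
    using exp_bound_half[of "1/2::real"] by (intro mult_right_mono) auto
  also have "\<dots> \<le> 2 * (1 - tanh \<xi> ^ 2)"
    using exp_minus_abs_le_sech2[of \<xi>] by simp
  finally have "s * exp (- 2 * \<bar>\<tau>\<bar>) \<le> s * (2 * (1 - tanh \<xi> ^ 2))"
    using assms(1) by (rule mult_left_mono)
  then show ?thesis by (simp only: \<xi>(3) mult.left_commute[of s 2])
qed simp

lemma artanh_le:
  fixes u :: real
  assumes "0 \<le> u" "u \<le> 1 / 2"
  shows "artanh u \<le> u * (1 + 2 * u)"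
proof -
  have "ln (1 + u) \<le> u" using ln_add_one_self_le_self assms by simp
  moreover have "ln (inverse (1 - u)) \<le> inverse (1 - u) - 1"
    using assms by (intro ln_le_minus_one) auto
  moreover have "inverse (1 - u) - 1 \<le> u * (1 + 2 * u)"
  proof -
    \<comment> \<open>The right side exceeds \<open>1\<close> by
      \<open>u * u * (1 - 2 * u)\<close>.\<close>
    have "1 \<le> (1 + u * (1 + 2 * u)) * (1 - u)"
      using assms mult_nonneg_nonneg[of "u * u" "1 - 2 * u"] by (simp add: algebra_simps)
    then have "1 / (1 - u) \<le> 1 + u * (1 + 2 * u)"
      using assms by (subst pos_divide_le_eq) auto
    then show ?thesis by (simp add: inverse_eq_divide)
  qed
  moreover have "artanh u = (ln (1 + u) + ln (inverse (1 - u))) / 2"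
    using assms by (simp add: artanh_def ln_div ln_inverse)
  moreover have "u \<le> u * (1 + 2 * u)" using assms by (simp add: algebra_simps)
  ultimately show ?thesis by simp
qed

text \<open>Two errors are separated: the factor \<open>1 + 4 * s\<close> comes from the curvature
  of \<open>artanh\<close>, and the exponential term from \<open>1 / tanh R\<close>, which differs
  from \<open>1\<close> by at most \<open>4 * exp (- 2 * R)\<close>.\<close>

lemma artanh_quotient_le:
  fixes s R :: real
  assumes s: "0 \<le> s" "s \<le> 1 / 4" and R: "1 \<le> R"
  shows "artanh (tanh s / tanh R) \<le> (1 + 4 * s) * s + 8 * s * exp (- 2 * R)"
proof -
  define E where "E = exp (- 2 * R)"
  have "E \<le> exp (- 2)" using R by (simp add: E_def)
  also have "exp (- 2 :: real) \<le> 1 / 4"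
  proof -
    have "4 \<le> exp (2::real)" using exp_lower_Taylor_quadratic[of "2::real"] by simp
    then have "inverse (exp 2) \<le> inverse (4::real)" by (intro le_imp_inverse_le) auto
    then show ?thesis by (simp add: exp_minus)
  qed
  finally have E: "0 < E" "E \<le> 1 / 4" by (auto simp: E_def)
  define u where "u = tanh s / tanh R"
  have coth: "1 / tanh R \<le> 1 + 4 * E"
  proof -
    have "tanh R = (1 - E) / (1 + E)" by (simp only: tanh_real_altdef E_def)
    then have "1 / tanh R = (1 + E) / (1 - E)" by simp
    \<comment> \<open>After clearing the denominator the gap is
      \<open>2 * E * (1 - 2 * E)\<close>.\<close>
    also have "\<dots> \<le> 1 + 4 * E"
      using E mult_nonneg_nonneg[of E "1 - 2 * E"]
      by (subst pos_divide_le_eq) (auto simp: algebra_simps)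
    finally show ?thesis .
  qed
  have "u = tanh s * (1 / tanh R)" by (simp add: u_def)
  also have "\<dots> \<le> s * (1 + 4 * E)"
    using coth tanh_le_self[OF s(1)] s R by (intro mult_mono) auto
  finally have u: "u \<le> s * (1 + 4 * E)" .
  have "s * (1 + 4 * E) \<le> s * 2" using s E by (intro mult_left_mono) auto
  then have u2: "u \<le> 2 * s" using u by simp
  have u0: "0 \<le> u" using s R by (simp add: u_def)
  have "artanh u \<le> u * (1 + 2 * u)" using u0 u2 s by (intro artanh_le) auto
  also have "\<dots> \<le> (s * (1 + 4 * E)) * (1 + 4 * s)"
    using u u2 u0 s E by (intro mult_mono) auto
  also have "\<dots> = (1 + 4 * s) * s + s * E * (4 * (1 + 4 * s))" by (simp add: algebra_simps)
  also have "\<dots> \<le> (1 + 4 * s) * s + s * E * 8"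
    using s E by (intro add_left_mono mult_left_mono) auto
  finally show ?thesis by (simp add: u_def E_def mult_ac)
qed

section \<open>Consequences of the weak Gromov property\<close>

text \<open>For \<open>q\<close> in \<open>\<Omega>\<close> this is the triangle inequality with a
  local bound at \<open>q\<close>, on the boundary it is the weak Gromov property, and off the
  closure it is vacuous.\<close>

lemma v_point_near:
  fixes \<Omega> :: "(complex ^ 'n) set"
  assumes \<Omega>: "is_domain \<Omega>" and v: "v_point \<Omega> p" and o': "o' \<in> \<Omega>" and q: "q \<noteq> p"
  shows "\<exists>N V C. open N \<and> q \<in> N \<and> open V \<and> p \<in> V \<and>
           (\<forall>x\<in>\<Omega> \<inter> V. \<forall>u\<in>\<Omega> \<inter> N. kobayashi \<Omega> x o' - C \<le> kobayashi \<Omega> x u)"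
proof -
  have op: "open \<Omega>" using \<Omega> by (simp add: is_domain_def)
  consider "q \<in> \<Omega>" | "q \<in> frontier \<Omega>" | "q \<in> - closure \<Omega>"
    using op closure_subset by (auto simp: frontier_def interior_open)
  then show ?thesis
  proof cases
    case 1
    then obtain r where r: "r > 0" "ball q r \<subseteq> \<Omega>" using op openE by blast
    have "kobayashi \<Omega> x o' - (kobayashi \<Omega> q o' + artanh (1 / 2)) \<le> kobayashi \<Omega> x u"
      if "x \<in> \<Omega>" "u \<in> \<Omega>" "dist q u < r / 2" for x u
      using kobayashi_triangle[OF \<Omega> that(1,2) o'] kobayashi_triangle[OF \<Omega> that(2) 1 o']
        kobayashi_commute[OF \<Omega> that(2) 1] kobayashi_locally_bounded[OF \<Omega> r(2) that(3)]
      by linarith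
    then show ?thesis
      using r(1) by (intro exI[of _ "ball q (r / 2)"] exI[of _ UNIV]
          exI[of _ "kobayashi \<Omega> q o' + artanh (1 / 2)"]) auto
  next
    case 2
    then have "Liminf (at (p, q) within \<Omega> \<times> \<Omega>)
          (\<lambda>(z, w). ereal (kobayashi \<Omega> z w - kobayashi \<Omega> z o')) > -\<infinity>"
      using v o' q by (auto simp: v_point_def)
    then obtain c :: real where
      "ereal c < Liminf (at (p, q) within \<Omega> \<times> \<Omega>)
          (\<lambda>(z, w). ereal (kobayashi \<Omega> z w - kobayashi \<Omega> z o'))"
      using ereal_dense2 by blast
    from less_LiminfD[OF this] obtain S where S: "open S" "(p, q) \<in> S"
      "\<And>x u. (x, u) \<in> S \<Longrightarrow> (x, u) \<noteq> (p, q) \<Longrightarrow> x \<in> \<Omega> \<Longrightarrow> u \<in> \<Omega> \<Longrightarrow>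
         c < kobayashi \<Omega> x u - kobayashi \<Omega> x o'"
      unfolding eventually_at_topological by fastforce
    obtain V N where VN: "open V" "open N" "(p, q) \<in> V \<times> N" "V \<times> N \<subseteq> S"
      using open_prod_elim[OF S(1,2)] by blast
    \<comment> \<open>The limit inferior ignores the pair \<open>(p, q)\<close> itself; it is not
      among the pairs considered, since \<open>q\<close> lies outside
      \<open>\<Omega>\<close>.\<close>
    have "q \<notin> \<Omega>" using 2 op by (simp add: frontier_def interior_open)
    then have "kobayashi \<Omega> x o' - (- c) \<le> kobayashi \<Omega> x u" if "x \<in> \<Omega> \<inter> V" "u \<in> \<Omega> \<inter> N" for x u
      using S(3)[of x u] VN(4) that by force
    then show ?thesis
      using VN by (intro exI[of _ N] exI[of _ V] exI[of _ "- c"]) auto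
  next
    case 3
    then show ?thesis
      using closure_subset[of \<Omega>] by (intro exI[of _ "- closure \<Omega>"] exI[of _ UNIV]) auto
  qed
qed

text \<open>The complement of \<open>U\<close> need not be compact, but a small sphere about
  \<open>p\<close> is, so finitely many local bounds cover it. A chain from near \<open>p\<close> to
  a point outside \<open>U\<close> crosses this sphere.\<close>

lemma v_point_distance_to_complement:
  fixes \<Omega> :: "(complex ^ 'n) set"
  assumes \<Omega>: "is_domain \<Omega>" and v: "v_point \<Omega> p" and o': "o' \<in> \<Omega>"
    and U: "open U" "p \<in> U"
  obtains V C where "open V" "p \<in> V" "V \<subseteq> U"
    "\<And>x u. x \<in> \<Omega> \<inter> V \<Longrightarrow> u \<in> \<Omega> - U \<Longrightarrow> kobayashi \<Omega> x o' - C \<le> kobayashi \<Omega> x u"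
proof -
  obtain r where r: "r > 0" "ball p r \<subseteq> U" using U openE by blast
  have "\<forall>q\<in>sphere p r. \<exists>N V C. open N \<and> q \<in> N \<and> open V \<and> p \<in> V \<and>
           (\<forall>x\<in>\<Omega> \<inter> V. \<forall>u\<in>\<Omega> \<inter> N. kobayashi \<Omega> x o' - C \<le> kobayashi \<Omega> x u)"
    using v_point_near[OF \<Omega> v o'] r(1) by auto
  then obtain N V C where NVC: "\<And>q. q \<in> sphere p r \<Longrightarrow> open (N q) \<and> q \<in> N q \<and> open (V q) \<and> p \<in> V q \<and>
           (\<forall>x\<in>\<Omega> \<inter> V q. \<forall>u\<in>\<Omega> \<inter> N q. kobayashi \<Omega> x o' - C q \<le> kobayashi \<Omega> x u)"
    by metis
  obtain T where T: "T \<subseteq> sphere p r" "finite T" "sphere p r \<subseteq> (\<Union>q\<in>T. N q)"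
    using compactE_image[OF compact_sphere, of "sphere p r" N p r] NVC by blast
  define W where "W = ball p r \<inter> (\<Inter>q\<in>T. V q)"
  define B where "B = (\<Sum>q\<in>T. \<bar>C q\<bar>)"
  have sphere: "kobayashi \<Omega> x o' - B \<le> kobayashi \<Omega> x y"
    if x: "x \<in> \<Omega> \<inter> W" and y: "y \<in> \<Omega>" "dist p y = r" for x y
  proof -
    obtain q where q: "q \<in> T" "y \<in> N q" using T(3) y by auto
    have "C q \<le> B" using member_le_sum[of q T "\<lambda>q. \<bar>C q\<bar>"] q(1) T(2) by (simp add: B_def)
    moreover have "kobayashi \<Omega> x o' - C q \<le> kobayashi \<Omega> x y"
      using NVC[of q] q T(1) x y(1) by (auto simp: W_def)
    ultimately show ?thesis by linarith
  qed
  show thesis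
  proof
    show "open W" unfolding W_def using NVC T by (intro open_Int open_INT) auto
    show "p \<in> W" using NVC T(1) r(1) by (auto simp: W_def)
    show "W \<subseteq> U" using r(2) by (auto simp: W_def)
    fix x u assume x: "x \<in> \<Omega> \<inter> W" and u: "u \<in> \<Omega> - U"
    have xr: "dist p x < r" using x by (auto simp: W_def)
    have ur: "r \<le> dist p u" using u r(2) by (meson DiffD2 mem_ball not_less subsetD)
    show "kobayashi \<Omega> x o' - B \<le> kobayashi \<Omega> x u"
    proof (rule dense_ge)
      fix c assume "kobayashi \<Omega> x u < c"
      then obtain t where t: "t < c" "fine_chain \<Omega> 1 x u t"
        using fine_chain_less[OF \<Omega>, of x u 1 c] x u by auto
      obtain y where "y \<in> \<Omega>" "dist p y = r" "kobayashi \<Omega> x y \<le> t"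
        using fine_chain_crosses_sphere[OF \<Omega> t(2) xr ur] by blast
      then show "kobayashi \<Omega> x o' - B \<le> c" using sphere[OF x] t(1) by force
    qed
  qed
qed

section \<open>Localization along a chain\<close>

lemma is_domain_component:
  assumes "is_domain \<Omega>" "open U" "a \<in> \<Omega> \<inter> U"
  shows "is_domain (connected_component_set (\<Omega> \<inter> U) a)"
  unfolding is_domain_def
proof (intro conjI)
  show "open (connected_component_set (\<Omega> \<inter> U) a)"
    using assms by (intro open_connected_component open_Int) (auto simp: is_domain_def)
qed (use assms(3) connected_component_eq_empty[of "\<Omega> \<inter> U" a] in auto)

text \<open>The remaining length \<open>t0\<close> is where the lower bounds for the distance to \<open>o'\<close> given by the
  triangle inequalities through \<open>z\<close> and through \<open>w\<close> coincide. The increments of \<open>tanh\<close> dominate the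
  errors of the single discs and telescope.\<close>

lemma fine_chain_localize:
  fixes \<Omega> :: "(complex ^ 'n) set"
  assumes \<Omega>: "is_domain \<Omega>" and U: "open U" and zo: "z \<in> \<Omega>" "o' \<in> \<Omega>"
    and \<delta>: "\<delta> \<le> 1 / 4" and M: "1 \<le> M"
    and D: "D = connected_component_set (\<Omega> \<inter> U) a" "a \<in> \<Omega> \<inter> U"
    and V: "\<And>y. y \<in> \<Omega> \<Longrightarrow> kobayashi \<Omega> z y + kobayashi \<Omega> y w \<le> T \<Longrightarrow> y \<in> V"
    and C: "\<And>x u. x \<in> \<Omega> \<inter> V \<Longrightarrow> u \<in> \<Omega> - U \<Longrightarrow> kobayashi \<Omega> x o' - C \<le> kobayashi \<Omega> x u"
    and MC: "2 * (M + C) \<le> kobayashi \<Omega> z o' + kobayashi \<Omega> w o' - T"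
    and t0: "t0 = (kobayashi \<Omega> w o' - kobayashi \<Omega> z o' + T) / 2"
    and chain: "fine_chain \<Omega> \<delta> x w t" and x: "x \<in> D" "kobayashi \<Omega> z x \<le> T - t"
  shows "w \<in> D \<and> kobayashi D x w \<le>
           (1 + 4 * \<delta>) * t + 16 * exp (- 2 * M) * (tanh (t - t0) - tanh (- t0))"
proof -
  have D\<Omega>: "D \<subseteq> \<Omega> \<inter> U" unfolding D(1) by (rule connected_component_subset)
  have domD: "is_domain D"
    unfolding D(1) by (rule is_domain_component[OF \<Omega> U D(2)])
  have step: "y \<in> D \<and> kobayashi D x y \<le>
      (1 + 4 * \<delta>) * s + 16 * exp (- 2 * M) * (tanh (s + t - t0) - tanh (t - t0))"
    if xy: "disc_step \<Omega> x y s" "s \<le> \<delta>" and ch: "fine_chain \<Omega> \<delta> x w (s + t)"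
      and xD: "x \<in> D" and zx: "kobayashi \<Omega> z x \<le> T - (s + t)" for x y s t
  proof -
    define R where "R = M + \<bar>s + t - t0\<bar>"
    have inn: "x \<in> \<Omega>" "x \<in> U" "w \<in> \<Omega>" "0 \<le> s"
      using xD D\<Omega> fine_chain_in[OF ch] disc_step_in[OF xy(1)] by auto
    have xw: "kobayashi \<Omega> x w \<le> s + t" by (rule kobayashi_le_fine_chain[OF \<Omega> ch])
    have "x \<in> V" using V[OF inn(1)] xw zx by simp
    \<comment> \<open>Of the two lower bounds, through \<open>z\<close> and through
      \<open>w\<close>, the average is at least \<open>M + C\<close> by \<open>MC\<close> and half
      the difference is \<open>s + t - t0\<close>. The larger one is therefore at least
      \<open>M + C + \<bar>s + t - t0\<bar>\<close>.\<close>
    have "R \<le> kobayashi \<Omega> x o' - C"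
    proof -
      have "kobayashi \<Omega> z o' - (T - (s + t)) \<le> kobayashi \<Omega> x o'"
        using kobayashi_triangle[OF \<Omega> zo(1) inn(1) zo(2)] zx by simp
      moreover have "kobayashi \<Omega> w o' - (s + t) \<le> kobayashi \<Omega> x o'"
        using kobayashi_triangle[OF \<Omega> inn(3,1) zo(2)] kobayashi_commute[OF \<Omega> inn(3,1)] xw by simp
      ultimately show ?thesis
        using MC unfolding R_def t0 by (simp add: abs_if field_simps)
    qed
    then have R: "R \<le> kobayashi \<Omega> x u" if "u \<in> \<Omega> - U" for u
      using C[of x u] that inn(1) \<open>x \<in> V\<close> by simp
    have R1: "1 \<le> R" using M by (simp add: R_def)
    have sR: "s < R" using xy(2) \<delta> R1 by simp
    have "connected_component_set (\<Omega> \<inter> U) x = D"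
      using connected_component_eq xD unfolding D(1) by blast
    with disc_step_localize[OF \<Omega> xy(1) inn(2) sR R]
    have st: "disc_step D x y (artanh (tanh s / tanh R))" by simp
    have "kobayashi D x y \<le> artanh (tanh s / tanh R)"
      by (rule kobayashi_le_disc_step[OF domD st])
    also have "\<dots> \<le> (1 + 4 * s) * s + 8 * s * exp (- 2 * R)"
      using artanh_quotient_le[of s R] inn(4) xy(2) \<delta> R1 by simp
    also have "\<dots> \<le> (1 + 4 * \<delta>) * s + 16 * exp (- 2 * M) * (tanh (s + t - t0) - tanh (t - t0))"
    proof (rule add_mono)
      show "(1 + 4 * s) * s \<le> (1 + 4 * \<delta>) * s" using inn(4) xy(2) by (intro mult_right_mono) auto
      have "8 * s * exp (- 2 * R) = 8 * exp (- 2 * M) * (s * exp (- 2 * \<bar>s + t - t0\<bar>))"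
        by (simp add: R_def exp_add[symmetric] algebra_simps)
      also have "\<dots> \<le> 8 * exp (- 2 * M) * (2 * (tanh (s + t - t0) - tanh (s + t - t0 - s)))"
        using inn(4) xy(2) \<delta> by (intro mult_left_mono exp_le_tanh_increment) auto
      finally show "8 * s * exp (- 2 * R) \<le>
          16 * exp (- 2 * M) * (tanh (s + t - t0) - tanh (t - t0))"
        by (simp add: algebra_simps)
    qed
    finally show ?thesis using disc_step_in[OF st] by simp
  qed
  \<comment> \<open>Rule induction needs a variable end point, while \<open>step\<close> concerns
    the fixed \<open>w\<close>; the equation \<open>w' = w\<close> links them.\<close>
  have "w' = w \<Longrightarrow> x \<in> D \<Longrightarrow> kobayashi \<Omega> z x \<le> T - t \<Longrightarrow> w' \<in> D \<and> kobayashi D x w' \<le>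
           (1 + 4 * \<delta>) * t + 16 * exp (- 2 * M) * (tanh (t - t0) - tanh (- t0))"
    if "fine_chain \<Omega> \<delta> x w' t" for x w' t
    using that
  proof induction
    case (nil x)
    then show ?case using kobayashi_refl[OF domD] by simp
  next
    case (cons x y s w' t)
    have ch: "fine_chain \<Omega> \<delta> x w (s + t)"
      using fine_chain.cons[OF cons.hyps] cons.prems(1) by simp
    have y: "y \<in> D" "kobayashi D x y \<le>
      (1 + 4 * \<delta>) * s + 16 * exp (- 2 * M) * (tanh (s + t - t0) - tanh (t - t0))"
      using step[OF cons.hyps(1,2) ch cons.prems(2,3)] by auto
    have "kobayashi \<Omega> z y \<le> T - t"
      using kobayashi_triangle[OF \<Omega> zo(1) disc_step_in(1,2)[OF cons.hyps(1)]] cons.prems(3)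
        kobayashi_le_disc_step[OF \<Omega> cons.hyps(1)] by simp
    from cons.IH[OF cons.prems(1) y(1) this]
    have IH: "w' \<in> D" "kobayashi D y w' \<le>
           (1 + 4 * \<delta>) * t + 16 * exp (- 2 * M) * (tanh (t - t0) - tanh (- t0))"
      by auto
    then show ?case
      using kobayashi_triangle[OF domD cons.prems(2) y(1) IH(1)] y(2)
      by (simp add: algebra_simps)
  qed
  from this[OF chain refl x] show ?thesis .
qed

section \<open>Choice of the constants and the limit at \<open>p\<close>\<close>

theorem theorem4:
  fixes \<Omega> U :: "(complex ^ 'n) set" and p :: "complex ^ 'n"
  assumes "is_domain \<Omega>"
    and "p \<in> frontier \<Omega>"
    and "v_point \<Omega> p"
    and "w_point \<Omega> p"
    and "open U" and "p \<in> U"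
  shows "((\<lambda>(z, w). kobayashi_comp (\<Omega> \<inter> U) z w - kobayashi \<Omega> z w) \<longlongrightarrow> 0)
           (at (p, p) within {(z, w). connected_component (\<Omega> \<inter> U) z w})"
proof (cases "\<Omega> \<subseteq> U")
  case True
  then have "\<Omega> \<inter> U = \<Omega>" by blast
  moreover have "connected_component_set \<Omega> z = \<Omega>" if "z \<in> \<Omega>" for z
    using assms(1) that by (simp add: is_domain_def connected_component_eq_self)
  ultimately have "(case zw of (z, w) \<Rightarrow> kobayashi_comp (\<Omega> \<inter> U) z w - kobayashi \<Omega> z w) = 0"
    if "zw \<in> {(z, w). connected_component (\<Omega> \<inter> U) z w}" for zw
    using that connected_component_in[of \<Omega>] by (auto simp: kobayashi_comp_def)
  then show ?thesis
    by (intro tendsto_eventually) (simp add: eventually_at_filter)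
next
  case False
  note \<Omega> = assms(1)
  let ?K = "{(z, w). connected_component (\<Omega> \<inter> U) z w}"
  have K: "?K \<subseteq> \<Omega> \<times> \<Omega>" by (auto dest: connected_component_in)
  \<comment> \<open>A base point outside \<open>U\<close> is also outside \<open>V\<close>, so the
    \<open>w\<close>-point property for \<open>V\<close> makes the Gromov product at
    \<open>o'\<close> large as well.\<close>
  obtain o' where o': "o' \<in> \<Omega> - U" using False by blast
  obtain V C where V: "open V" "p \<in> V" "V \<subseteq> U"
    and C: "\<And>x u. x \<in> \<Omega> \<inter> V \<Longrightarrow> u \<in> \<Omega> - U \<Longrightarrow> kobayashi \<Omega> x o' - C \<le> kobayashi \<Omega> x u"
    using v_point_distance_to_complement[OF \<Omega> assms(3) _ assms(5,6)] o' by blast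
  show ?thesis
  proof (rule tendstoI)
    fix e :: real assume e: "0 < e"
    \<comment> \<open>An increment of \<open>tanh\<close> is at most \<open>2\<close>, so the
      exponential error is at most \<open>32 * exp (- 2 * M)\<close>, that is
      \<open>e / 4\<close>.\<close>
    define M where "M = max 1 (- ln (e / 128) / 2)"
    have M: "1 \<le> M" by (simp add: M_def)
    have "exp (- 2 * M) \<le> exp (ln (e / 128))" by (simp add: M_def)
    then have expM: "exp (- 2 * M) \<le> e / 128" using e by simp
    \<comment> \<open>The summand \<open>1\<close> absorbs the excess \<open>\<eta>\<close> of the
      chain over the distance of \<open>z\<close> and \<open>w\<close>.\<close>
    define B where "B = M + \<bar>C\<bar> + 1"
    have "filterlim (\<lambda>(z, w). INF u\<in>\<Omega> - V. gromov_product \<Omega> u z w) at_top (at (p, p) within ?K)"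
    proof (rule filterlim_mono[OF _ order_refl at_le[OF K]])
      have "\<Omega> - V \<noteq> {}" using V(3) o' by blast
      then show "filterlim (\<lambda>(z, w). INF u\<in>\<Omega> - V. gromov_product \<Omega> u z w) at_top
          (at (p, p) within \<Omega> \<times> \<Omega>)"
        using assms(4) V(1,2) unfolding w_point_def by blast
    qed
    then have "\<forall>\<^sub>F zw in at (p, p) within ?K.
        B \<le> (case zw of (z, w) \<Rightarrow> INF u\<in>\<Omega> - V. gromov_product \<Omega> u z w)"
      by (simp add: filterlim_at_top)
    moreover have "\<forall>\<^sub>F zw in at (p, p) within ?K. zw \<in> ?K"
      by (simp add: eventually_at_filter)
    ultimately show "\<forall>\<^sub>F zw in at (p, p) within ?K.
        dist (case zw of (z, w) \<Rightarrow> kobayashi_comp (\<Omega> \<inter> U) z w - kobayashi \<Omega> z w) 0 < e"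
    proof eventually_elim
      case (elim zw)
      obtain z w where zw: "zw = (z, w)" by fastforce
      have cc: "connected_component (\<Omega> \<inter> U) z w" using elim(2) zw by simp
      have zw\<Omega>: "z \<in> \<Omega>" "w \<in> \<Omega>" "z \<in> \<Omega> \<inter> U" using connected_component_in[OF cc] by auto
      define D where "D = connected_component_set (\<Omega> \<inter> U) z"
      have zwD: "z \<in> D" "w \<in> D" using cc zw\<Omega>(3) by (auto simp: D_def)
      have domD: "is_domain D"
        unfolding D_def by (rule is_domain_component[OF \<Omega> assms(5) zw\<Omega>(3)])
      have D\<Omega>: "D \<subseteq> \<Omega>" unfolding D_def using connected_component_subset by blast
      have gromov: "B \<le> gromov_product \<Omega> u z w" if u: "u \<in> \<Omega> - V" for u
      proof -
        have "0 \<le> gromov_product \<Omega> v z w" if "v \<in> \<Omega>" for v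
          using kobayashi_triangle[OF \<Omega> zw\<Omega>(1) that zw\<Omega>(2)] kobayashi_commute[OF \<Omega> zw\<Omega>(2) that]
          by (simp add: gromov_product_def)
        then have "(INF u\<in>\<Omega> - V. gromov_product \<Omega> u z w) \<le> gromov_product \<Omega> u z w"
          by (intro cINF_lower[OF bdd_belowI2[of _ 0]] u) auto
        then show ?thesis using elim(1) zw by simp
      qed
      define L where "L = kobayashi \<Omega> z w"
      have L: "0 \<le> L" unfolding L_def by (rule kobayashi_nonneg[OF \<Omega> zw\<Omega>(1,2)])
      define \<eta> where "\<eta> = min 1 (e / 4)"
      \<comment> \<open>The mesh depends on the pair through \<open>L\<close>, for which no uniform
        bound near \<open>p\<close> is available; it makes \<open>4 * \<delta> * (L + 1)\<close> at
        most \<open>e / 4\<close>.\<close>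
      define \<delta> where "\<delta> = min (1 / 4) (e / (16 * (L + 1)))"
      have \<eta>: "0 < \<eta>" "\<eta> \<le> 1" "\<eta> \<le> e / 4" using e by (auto simp: \<eta>_def)
      have "0 < \<delta>" using e L by (simp add: \<delta>_def)
      moreover have "\<delta> \<le> 1 / 4" unfolding \<delta>_def by (rule min.cobounded1)
      ultimately have \<delta>: "0 < \<delta>" "\<delta> \<le> 1 / 4" .
      have \<delta>L: "\<delta> * (16 * (L + 1)) \<le> e"
        using L by (subst pos_le_divide_eq[symmetric]) (auto simp: \<delta>_def)
      obtain T where T: "T < L + \<eta>" "fine_chain \<Omega> \<delta> z w T"
        using fine_chain_less[OF \<Omega> zw\<Omega>(1,2) \<delta>(1), of "L + \<eta>"] \<eta>(1) unfolding L_def by auto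
      define t0 where "t0 = (kobayashi \<Omega> w o' - kobayashi \<Omega> z o' + T) / 2"
      \<comment> \<open>At such a \<open>y\<close> the Gromov product of \<open>z\<close> and
        \<open>w\<close> is below \<open>\<eta> / 2\<close>, whereas it is at least \<open>B\<close>
        everywhere outside \<open>V\<close>.\<close>
      have inV: "y \<in> V" if "y \<in> \<Omega>" "kobayashi \<Omega> z y + kobayashi \<Omega> y w \<le> T" for y
      proof (rule ccontr)
        assume "y \<notin> V"
        then have "B \<le> gromov_product \<Omega> y z w" using gromov that(1) by simp
        then show False
          using that T(1) \<eta>(2) M kobayashi_commute[OF \<Omega> zw\<Omega>(2) that(1)]
          by (simp add: gromov_product_def B_def L_def)
      qed
      have "o' \<in> \<Omega> - V" using o' V(3) by blast
      then have MC: "2 * (M + C) \<le> kobayashi \<Omega> z o' + kobayashi \<Omega> w o' - T"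
        using gromov[of o'] T(1) \<eta>(2) abs_ge_self[of C]
        unfolding gromov_product_def B_def L_def by argo
      have "kobayashi D z w \<le>
           (1 + 4 * \<delta>) * T + 16 * exp (- 2 * M) * (tanh (T - t0) - tanh (- t0))"
        using fine_chain_localize[OF \<Omega> assms(5) zw\<Omega>(1) _ \<delta>(2) M D_def zw\<Omega>(3) inV C MC t0_def T(2) zwD(1)]
          o' kobayashi_refl[OF \<Omega> zw\<Omega>(1)] by simp
      also have "\<dots> \<le> (1 + 4 * \<delta>) * (L + \<eta>) + 16 * exp (- 2 * M) * 2"
        using T(1) \<delta>(1) tanh_real_lt_1[of "T - t0"] tanh_real_gt_neg1[of "- t0"]
        by (intro add_mono mult_left_mono) auto
      \<comment> \<open>The excess \<open>\<eta>\<close>, the mesh and the exponential term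
        contribute \<open>e / 4\<close> each.\<close>
      also have "\<dots> \<le> L + 3 / 4 * e"
      proof -
        have "4 * \<delta> * (L + \<eta>) \<le> 4 * \<delta> * (L + 1)" using \<delta>(1) \<eta>(2) by (intro mult_left_mono) auto
        also have "\<dots> \<le> e / 4" using \<delta>L by (simp add: algebra_simps)
        finally show ?thesis using \<eta>(3) expM by (simp add: distrib_right)
      qed
      finally have "kobayashi D z w - kobayashi \<Omega> z w < e" using e by (simp add: L_def)
      moreover have "kobayashi \<Omega> z w \<le> kobayashi D z w"
        by (rule kobayashi_mono[OF \<Omega> domD D\<Omega> zwD])
      ultimately show ?case by (simp add: zw kobayashi_comp_def D_def)
    qed
  qed
qed

end
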